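(* Let $d\in\mathbb{N}$, $0<p<\infty$ and $\varphi\in\mathcal{G}_p$ with $\varphi(1)=1$. Assume that $\lim_{t\to0^+}\varphi(t)=0$. Let $\mathcal{E}_{\mathsf G}^{X}$ denote the growth envelope function of $X=\mathcal{M}_{\varphi,p}(\mathbb{R}^d)$. Then $$\mathcal{E}_{\mathsf G}^{X}(t)=\infty\ \text{ for all } t>0\qquad\text{if, and only if,}\qquad \lim_{t\to\infty}t^{-d/p}\varphi(t)=0.$$
   Context: $\mathcal{G}_p$ is the set of all nondecreasing functions $\varphi:(0,\infty)\to(0,\infty)$ such that $t\mapsto \varphi(t)t^{-d/p}$ is nonincreasing. For $\varphi\in\mathcal{G}_p$, the generalised Morrey space $\mathcal{M}_{\varphi,p}(\mathbb{R}^d)$ is the set of all $f\in L_p^{\mathrm{loc}}(\mathbb{R}^d)$ with $$\|f\mid\mathcal{M}_{\varphi,p}(\mathbb{R}^d)\|:=\sup_{Q}\varphi(\ell(Q))\Big(\frac{1}{|Q|}\int_Q|f(y)|^p\,dy\Big)^{1/p}<\infty,$$ the supremum being over all dyadic cubes $Q=2^{-j}([0,1)^d+k)$, $j\in\mathbb{Z}$, $k\in\mathbb{Z}^d$, where $\ell(Q)$ is the side length; taking all cubes with sides parallel to the axes (or all balls, with the radius in place of $\ell(Q)$) gives an equivalent quasi-norm. For measurable $f$ on $\mathbb{R}^d$, finite a.e., $f^*(t)=\inf\{\sigma>0:\ |\{x:|f(x)|>\sigma\}|\le t\}$, $t\ge 0$ (with $\inf\emptyset=\infty$). The growth envelope function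 of a quasi-normed function space $X$ on $\mathbb{R}^d$ is $\mathcal{E}_{\mathsf G}^{X}(t)=\sup_{\|f\mid X\|\le 1}f^*(t)\in[0,\infty]$, $t>0$. *)

theory Defs
  imports "HOL-Analysis.Analysis"
begin

text \<open>
  The Euclidean space of dimension \<open>d \<ge> 1\<close> is \<open>real ^ 'n\<close> with \<open>d = CARD('n)\<close>. Functions are
  complex-valued, and almost everywhere equal representatives are not identified: the quantities
  below do not distinguish them.
\<close>

text \<open>
  The class of admissible \<open>\<phi>\<close>. The values of \<open>\<phi>\<close> outside the positive half-line are irrelevant.
\<close>

definition morrey_weights :: "nat \<Rightarrow> real \<Rightarrow> (real \<Rightarrow> real) set" where
  "morrey_weights d p =
    {\<phi>. (\<forall>t>0. \<phi> t > 0) \<and> mono_on {0<..} \<phi> \<and>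
        antimono_on {0<..} (\<lambda>t. \<phi> t * t powr (- (real d / p)))}"

definition dyadic_cube :: "int \<Rightarrow> int ^ 'n \<Rightarrow> (real ^ 'n) set" where
  "dyadic_cube j k =
    (\<lambda>x. (2 powi (- j)) *\<^sub>R (x + (\<chi> i. real_of_int (k $ i)))) ` {x. \<forall>i. 0 \<le> x $ i \<and> x $ i < 1}"

definition Lp_loc :: "real \<Rightarrow> (real ^ 'n \<Rightarrow> complex) set" where
  "Lp_loc p =
    {f. f \<in> borel_measurable lebesgue \<and>
        (\<forall>K. compact K \<longrightarrow> set_integrable lebesgue K (\<lambda>x. norm (f x) powr p))}"

text \<open>
  The cube \<open>dyadic_cube j k\<close> has side length \<open>2 powi (- j)\<close>. The Bochner integral is only
  meaningful here for \<open>f \<in> Lp_loc p\<close>, so this is always used together with that condition.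
\<close>

definition morrey_norm :: "(real \<Rightarrow> real) \<Rightarrow> real \<Rightarrow> (real ^ 'n \<Rightarrow> complex) \<Rightarrow> ennreal" where
  "morrey_norm \<phi> p f =
    (SUP (j, k) \<in> UNIV. ennreal (\<phi> (2 powi (- j)) *
       (1 / measure lebesgue (dyadic_cube j k) *
         (LINT y:dyadic_cube j k|lebesgue. norm (f y) powr p)) powr (1 / p)))"

definition morrey_space :: "(real \<Rightarrow> real) \<Rightarrow> real \<Rightarrow> (real ^ 'n \<Rightarrow> complex) set" where
  "morrey_space \<phi> p = {f \<in> Lp_loc p. morrey_norm \<phi> p f < \<infinity>}"

definition decreasing_rearrangement :: "(real ^ 'n \<Rightarrow> complex) \<Rightarrow> real \<Rightarrow> ennreal" where
  "decreasing_rearrangement f t =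
    Inf {ennreal \<sigma> | \<sigma>. \<sigma> > 0 \<and> emeasure lebesgue {x. norm (f x) > \<sigma>} \<le> ennreal t}"

text \<open>
  A quasi-normed function space is given by its set \<open>X\<close> of elements and its quasi-norm \<open>N\<close>.
\<close>

definition growth_envelope ::
  "(real ^ 'n \<Rightarrow> complex) set \<Rightarrow> ((real ^ 'n \<Rightarrow> complex) \<Rightarrow> ennreal) \<Rightarrow> real \<Rightarrow> ennreal" where
  "growth_envelope X N t = (SUP f \<in> {f \<in> X. N f \<le> 1}. decreasing_rearrangement f t)"

end

theory Submission
  imports Defs
begin

text \<open>
  Write \<open>g t = t powr (- d / p) * \<phi> t\<close>, a nonincreasing function.

  If \<open>g\<close> does not tend to \<open>0\<close>, it is bounded below by some \<open>c > 0\<close>, and the unit ball of the Morrey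
  space then has \<open>\<integral>\<^sub>Q norm f powr p \<le> c powr (- p)\<close> for every dyadic cube \<open>Q\<close>. Since \<open>2 ^ d\<close> dyadic
  cubes of side \<open>2 ^ n\<close> exhaust the space as \<open>n \<rightarrow> \<infinity>\<close>, Chebyshev's inequality bounds \<open>f\<^sup>*\<close> uniformly.

  If \<open>g\<close> tends to \<open>0\<close>, choose for a given height \<open>M\<close> a side length \<open>l\<close> with \<open>\<phi> l * M \<le> 1\<close>, and let
  \<open>f\<close> be \<open>M\<close> times the indicator of \<open>N\<close> cubes of side \<open>l\<close> at mutual distance at least \<open>L\<close>. Cubes of
  side at most \<open>l\<close> cause no trouble since \<open>\<phi>\<close> is nondecreasing; cubes of side between \<open>l\<close> and \<open>L\<close>
  meet only one of the \<open>N\<close> cubes and are controlled since \<open>g\<close> is nonincreasing; cubes of side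
  beyond \<open>L\<close> are controlled by the smallness of \<open>g\<close> if \<open>L\<close> is large in terms of \<open>M\<close>, \<open>l\<close> and \<open>N\<close>.
\<close>

section \<open>Cubes\<close>

lemma dyadic_cube_iff:
  "x \<in> dyadic_cube j k \<longleftrightarrow>
    (\<forall>i. 2 powi (- j) * k $ i \<le> x $ i \<and> x $ i < 2 powi (- j) * k $ i + 2 powi (- j))"
  (is "_ \<longleftrightarrow> ?R")
proof -
  define s where "s = (2::real) powi (- j)"
  have s: "s > 0" by (simp add: s_def)
  have "x \<in> dyadic_cube j k \<longleftrightarrow>
      (\<forall>i. 0 \<le> (x /\<^sub>R s) $ i - k $ i \<and> (x /\<^sub>R s) $ i - k $ i < 1)" (is "?A \<longleftrightarrow> ?B")
  proof
    assume ?A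
    then obtain y where "x = s *\<^sub>R (y + (\<chi> i. real_of_int (k $ i)))" "\<forall>i. 0 \<le> y $ i \<and> y $ i < 1"
      by (auto simp: dyadic_cube_def s_def)
    then show ?B using s by simp
  next
    assume ?B
    moreover have "x = s *\<^sub>R ((x /\<^sub>R s - (\<chi> i. real_of_int (k $ i))) + (\<chi> i. real_of_int (k $ i)))"
      using s by simp
    ultimately show ?A
      unfolding dyadic_cube_def s_def[symmetric]
      by (intro image_eqI[where x = "x /\<^sub>R s - (\<chi> i. real_of_int (k $ i))"]) auto
  qed
  also have "\<dots> \<longleftrightarrow> ?R"
    using s unfolding s_def[symmetric] by (simp add: field_simps)
  finally show ?thesis .
qed

lemma dyadic_cube_borel [measurable]: "dyadic_cube j k \<in> sets borel"
proof -
  have "dyadic_cube j k = (\<Inter>i. {x. 2 powi (- j) * k $ i \<le> x $ i}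
      \<inter> {x. x $ i < 2 powi (- j) * k $ i + 2 powi (- j)})"
    by (auto simp: dyadic_cube_iff)
  also have "\<dots> \<in> sets borel"
    by (intro sets.countable_INT'' sets.Int borel_closed borel_open closed_Collect_le
        open_Collect_less continuous_intros) auto
  finally show ?thesis .
qed

lemma emeasure_lebesgue_cube:
  fixes a :: "real ^ 'n::finite"
  assumes "0 \<le> s"
  shows "emeasure lebesgue (cbox a (a + vec s)) = ennreal (s ^ CARD('n))"
    and "emeasure lebesgue (box a (a + vec s)) = ennreal (s ^ CARD('n))"
proof -
  have *: "a \<bullet> b \<le> (a + vec s) \<bullet> b" "(a + vec s - a) \<bullet> b = s" if "b \<in> Basis" for b
    using that assms by (auto simp: Basis_vec_def inner_axis algebra_simps)
  then have "(\<Prod>b\<in>Basis. (a + vec s - a) \<bullet> b) = s ^ CARD('n)"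
    by simp
  then show "emeasure lebesgue (cbox a (a + vec s)) = ennreal (s ^ CARD('n))"
    and "emeasure lebesgue (box a (a + vec s)) = ennreal (s ^ CARD('n))"
    using * by (auto simp: emeasure_lborel_cbox_eq emeasure_lborel_box_eq)
qed

text \<open>The half-open cube lies between the open and the closed box with the same corners, and
  these two have equal volume.\<close>

lemma emeasure_dyadic_cube:
  "emeasure lebesgue (dyadic_cube j k :: (real ^ 'n::finite) set)
    = ennreal ((2 powi (- j)) ^ CARD('n))"
proof -
  define a :: "real ^ 'n" where "a = (\<chi> i. 2 powi (- j) * k $ i)"
  have "box a (a + vec (2 powi (- j))) \<subseteq> dyadic_cube j k"
    "dyadic_cube j k \<subseteq> cbox a (a + vec (2 powi (- j)))"
    by (auto simp: dyadic_cube_iff a_def mem_box_cart less_imp_le)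
  then have "emeasure lebesgue (box a (a + vec (2 powi (- j)))) \<le> emeasure lebesgue (dyadic_cube j k)"
    "emeasure lebesgue (dyadic_cube j k) \<le> emeasure lebesgue (cbox a (a + vec (2 powi (- j))))"
    by (auto intro!: emeasure_mono)
  moreover have "0 \<le> (2::real) powi (- j)" by simp
  ultimately show ?thesis
    using emeasure_lebesgue_cube[of "2 powi (- j)" a] by (metis order_antisym)
qed

lemma measure_dyadic_cube:
  "measure lebesgue (dyadic_cube j k :: (real ^ 'n::finite) set) = (2 powi (- j)) ^ CARD('n)"
  by (simp add: measure_def emeasure_dyadic_cube)

lemma bounded_dyadic_cube: "bounded (dyadic_cube j k :: (real ^ 'n::finite) set)"
proof (rule bounded_subset[OF bounded_cbox])
  show "dyadic_cube j k \<subseteq> cbox (\<chi> i. 2 powi (- j) * k $ i)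
      (\<chi> i. 2 powi (- j) * k $ i + 2 powi (- j))"
    by (auto simp: dyadic_cube_iff mem_box_cart less_imp_le)
qed

section \<open>Uniform bounds on the unit ball\<close>

text \<open>No dyadic cube crosses a coordinate hyperplane, so exhausting the space takes one
  growing cube per orthant. The set \<open>S\<close> collects the coordinates that are
  negative.\<close>

definition orthant_cube :: "nat \<Rightarrow> 'n set \<Rightarrow> (real ^ 'n) set" where
  "orthant_cube n S = dyadic_cube (- int n) (\<chi> i. if i \<in> S then - 1 else 0)"

lemma orthant_cube_Union:
  "(\<Union>S. orthant_cube n S) = {x :: real ^ 'n::finite. \<forall>i. - (2 ^ n) \<le> x $ i \<and> x $ i < 2 ^ n}"
proof (intro equalityI subsetI)
  fix x :: "real ^ 'n"
  assume "x \<in> (\<Union>S. orthant_cube n S)"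
  then obtain S where x: "x \<in> orthant_cube n S" by blast
  have "- (2 ^ n) \<le> x $ i \<and> x $ i < 2 ^ n" for i
  proof -
    have "(0::real) < 2 ^ n" by simp
    then show ?thesis
      using x by (auto simp: orthant_cube_def dyadic_cube_iff split: if_splits dest!: spec[of _ i])
  qed
  then show "x \<in> {x. \<forall>i. - (2 ^ n) \<le> x $ i \<and> x $ i < 2 ^ n}"
    by blast
next
  fix x :: "real ^ 'n"
  assume "x \<in> {x. \<forall>i. - (2 ^ n) \<le> x $ i \<and> x $ i < 2 ^ n}"
  then have "x \<in> orthant_cube n {i. x $ i < 0}"
    by (auto simp: orthant_cube_def dyadic_cube_iff)
  then show "x \<in> (\<Union>S. orthant_cube n S)" by blast
qed

text \<open>Continuity from below along the boxes of half-side \<open>2 ^ n\<close>; subadditivity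
  over the sign patterns \<open>S\<close> produces the factor \<open>2 ^ CARD('n)\<close>.\<close>

lemma emeasure_le_of_orthant_cubes:
  fixes A :: "(real ^ 'n::finite) set"
  assumes A: "A \<in> sets lebesgue"
    and le: "\<And>n S. emeasure lebesgue (A \<inter> orthant_cube n S) \<le> ennreal b"
    and b: "0 \<le> b"
  shows "emeasure lebesgue A \<le> ennreal (2 ^ CARD('n) * b)"
proof -
  let ?B = "\<lambda>n. A \<inter> (\<Union>S. orthant_cube n S)"
  have m: "?B n \<in> sets lebesgue" for n
    using A by (intro sets.Int sets.finite_UN) (auto simp: orthant_cube_def)
  have inc: "incseq ?B"
  proof (rule incseq_SucI)
    fix n
    have "- (2 ^ Suc n) \<le> u \<and> u < 2 ^ Suc n" if "- (2 ^ n) \<le> u \<and> u < 2 ^ n" for u :: real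
      using that power_increasing[of n "Suc n" "2 :: real"] by linarith
    then show "?B n \<subseteq> ?B (Suc n)"
      unfolding orthant_cube_Union by blast
  qed
  have "(\<Union>n. ?B n) = A"
  proof -
    have "\<exists>n. \<forall>i. - (2 ^ n) \<le> x $ i \<and> x $ i < 2 ^ n" for x :: "real ^ 'n"
    proof -
      obtain n where n: "norm x < 2 ^ n"
        using real_arch_pow[of 2 "norm x"] by auto
      have "\<bar>x $ i\<bar> < 2 ^ n" for i
        using component_le_norm_cart[of x i] n by linarith
      then show ?thesis
        by (metis abs_less_iff less_imp_le minus_less_iff)
    qed
    then show ?thesis
      unfolding orthant_cube_Union by blast
  qed
  moreover have "(SUP n. emeasure lebesgue (?B n)) = emeasure lebesgue (\<Union>n. ?B n)"
    using m inc by (intro SUP_emeasure_incseq) auto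
  ultimately have "emeasure lebesgue A = (SUP n. emeasure lebesgue (?B n))"
    by presburger
  also have "\<dots> \<le> ennreal (2 ^ CARD('n) * b)"
  proof (rule SUP_least)
    fix n
    have "emeasure lebesgue (?B n) = emeasure lebesgue (\<Union>S. A \<inter> orthant_cube n S)"
      by (simp only: Int_UN_distrib)
    also have "\<dots> \<le> (\<Sum>S\<in>UNIV. emeasure lebesgue (A \<inter> orthant_cube n S))"
      using A by (intro emeasure_subadditive_finite) (auto simp: orthant_cube_def)
    also have "\<dots> \<le> (\<Sum>S\<in>(UNIV :: 'n set set). ennreal b)"
      by (intro sum_mono le)
    also have "\<dots> = ennreal (2 ^ CARD('n) * b)"
      using b by (simp add: card_UNIV_set ennreal_mult' ennreal_power[symmetric])
    finally show "emeasure lebesgue (?B n) \<le> ennreal (2 ^ CARD('n) * b)" .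
  qed
  finally show ?thesis .
qed

section \<open>From integral bounds on dyadic cubes to a bound on the rearrangement\<close>

text \<open>\<open>Lp_loc\<close> speaks of compact sets only; a half-open cube inherits
  integrability from its compact closure.\<close>

lemma set_integrable_Lp_loc_dyadic_cube:
  fixes f :: "real ^ 'n::finite \<Rightarrow> complex"
  assumes "f \<in> Lp_loc p"
  shows "set_integrable lebesgue (dyadic_cube j k) (\<lambda>x. norm (f x) powr p)"
proof (rule set_integrable_subset)
  show "set_integrable lebesgue (closure (dyadic_cube j k)) (\<lambda>x. norm (f x) powr p)"
    using assms compact_closure[THEN iffD2, OF bounded_dyadic_cube] unfolding Lp_loc_def by blast
qed (auto simp: closure_subset)

text \<open>For side \<open>s\<close> and integral \<open>I\<close>, the norm condition on this one
  cube reads \<open>\<phi> s * s powr (- d / p) * I powr (1 / p) \<le> 1\<close>. Replacing the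
  first two factors by \<open>c\<close> removes the side length, so the bound is the same for all
  cubes.\<close>

lemma set_integral_le_of_morrey_norm_le_1:
  fixes f :: "real ^ 'n::finite \<Rightarrow> complex"
  assumes p: "0 < p" and N: "morrey_norm \<phi> p f \<le> 1" and c: "0 < c"
    and g: "\<And>t. 0 < t \<Longrightarrow> c \<le> t powr (- (real CARD('n) / p)) * \<phi> t"
  shows "(LINT y:dyadic_cube j k|lebesgue. norm (f y) powr p) \<le> c powr (- p)"
proof -
  define s where "s = (2::real) powi (- j)"
  define I where "I = (LINT y:dyadic_cube j k|lebesgue. norm (f y) powr p)"
  have s: "s > 0" by (simp add: s_def)
  have I: "I \<ge> 0"
    by (auto simp: I_def set_lebesgue_integral_def intro!: integral_nonneg)
  have "ennreal (\<phi> s * (1 / s ^ CARD('n) * I) powr (1 / p)) \<le> morrey_norm \<phi> p f"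
    unfolding morrey_norm_def I_def s_def
    by (rule SUP_upper2[of "(j, k)"])
      (auto simp: measure_dyadic_cube)
  with N have le1: "\<phi> s * (1 / s ^ CARD('n) * I) powr (1 / p) \<le> 1"
    by (metis ennreal_le_1 order_trans)
  have "(s ^ CARD('n)) powr (1 / p) = s powr (real CARD('n) / p)"
    using s by (simp add: powr_powr flip: powr_realpow)
  then have "c * I powr (1 / p) \<le> \<phi> s * (1 / s ^ CARD('n) * I) powr (1 / p)"
    using mult_right_mono[OF g[OF s], of "I powr (1 / p)"] s I
    by (simp add: powr_mult powr_divide powr_minus field_simps)
  with le1 have "I powr (1 / p) \<le> 1 / c"
    using c by (simp add: field_simps)
  then have "(I powr (1 / p)) powr p \<le> (1 / c) powr p"
    using p by (intro powr_mono2) auto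
  then show ?thesis
    using p c I unfolding I_def[symmetric] by (simp add: powr_powr powr_divide powr_minus field_simps)
qed

text \<open>Markov's inequality for the \<open>p\<close>-th power, localised to \<open>Q\<close>
  because a locally integrable function offers no global integral.\<close>

lemma Chebyshev_emeasure_Int:
  fixes f :: "'a \<Rightarrow> complex"
  assumes f: "f \<in> borel_measurable M" and Q: "Q \<in> sets M"
    and int: "set_integrable M Q (\<lambda>x. norm (f x) powr p)"
    and C: "0 < C" and p: "0 < p"
  shows "emeasure M ({x \<in> space M. norm (f x) > C} \<inter> Q)
    \<le> ennreal ((LINT y:Q|M. norm (f y) powr p) / C powr p)"
proof -
  let ?u = "\<lambda>x. indicator Q x *\<^sub>R norm (f x) powr p"
  have "emeasure M ({x \<in> space M. norm (f x) > C} \<inter> Q) \<le> emeasure M {x \<in> space M. C powr p \<le> ?u x}"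
  proof (rule emeasure_mono)
    show "{x \<in> space M. norm (f x) > C} \<inter> Q \<subseteq> {x \<in> space M. C powr p \<le> ?u x}"
      using C p by (auto intro!: powr_mono2 simp: less_imp_le)
    show "{x \<in> space M. C powr p \<le> ?u x} \<in> sets M"
      using f Q by measurable
  qed
  also have "\<dots> \<le> ennreal (1 / C powr p * integral\<^sup>L M ?u)"
    using C int unfolding set_integrable_def
    by (intro integral_Markov_inequality) auto
  finally show ?thesis
    by (simp add: set_lebesgue_integral_def)
qed

lemma growth_envelope_finite:
  fixes \<phi> :: "real \<Rightarrow> real"
  assumes p: "0 < p" and c: "0 < c"
    and g: "\<And>t. 0 < t \<Longrightarrow> c \<le> t powr (- (real CARD('n::finite) / p)) * \<phi> t"
  shows "growth_envelope (morrey_space \<phi> p :: (real ^ 'n \<Rightarrow> complex) set) (morrey_norm \<phi> p) 1 < \<infinity>"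
proof -
  \<comment> \<open>Chosen so that the Chebyshev bounds of the orthants add up to exactly
    \<open>1\<close>, the argument at which the envelope is evaluated.\<close>
  define C where "C = (2 ^ CARD('n) * c powr (- p)) powr (1 / p)"
  have C: "C > 0" using c by (simp add: C_def)
  have Cp: "C powr p = 2 ^ CARD('n) * c powr (- p)"
    using p c by (simp add: C_def powr_powr)
  have "decreasing_rearrangement f 1 \<le> ennreal C"
    if f: "f \<in> morrey_space \<phi> p" "morrey_norm \<phi> p f \<le> 1" for f :: "real ^ 'n \<Rightarrow> complex"
  proof -
    have fL: "f \<in> Lp_loc p" using f by (simp add: morrey_space_def)
    then have fm: "f \<in> borel_measurable lebesgue" by (simp add: Lp_loc_def)
    have "emeasure lebesgue ({x. norm (f x) > C} \<inter> orthant_cube n S)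
        \<le> ennreal (c powr (- p) / C powr p)" for n S
    proof -
      have "emeasure lebesgue ({x \<in> space lebesgue. norm (f x) > C} \<inter> orthant_cube n S)
          \<le> ennreal ((LINT y:orthant_cube n S|lebesgue. norm (f y) powr p) / C powr p)"
        unfolding orthant_cube_def
        by (rule Chebyshev_emeasure_Int[OF fm _ set_integrable_Lp_loc_dyadic_cube[OF fL] C p]) simp
      also have "\<dots> \<le> ennreal (c powr (- p) / C powr p)"
        unfolding orthant_cube_def
        by (intro ennreal_leI divide_right_mono set_integral_le_of_morrey_norm_le_1[OF p f(2) c g])
          auto
      finally show ?thesis by simp
    qed
    moreover have "{x \<in> space lebesgue. norm (f x) > C} \<in> sets lebesgue"
      using fm by measurable
    then have "{x. norm (f x) > C} \<in> sets lebesgue"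
      by simp
    ultimately have "emeasure lebesgue {x. norm (f x) > C}
        \<le> ennreal (2 ^ CARD('n) * (c powr (- p) / C powr p))"
      by (intro emeasure_le_of_orthant_cubes) auto
    also have "\<dots> = ennreal 1"
      using c by (simp add: Cp)
    finally show ?thesis
      unfolding decreasing_rearrangement_def using C by (intro Inf_lower) auto
  qed
  then have "growth_envelope (morrey_space \<phi> p :: (real ^ 'n \<Rightarrow> complex) set) (morrey_norm \<phi> p) 1
      \<le> ennreal C"
    unfolding growth_envelope_def by (intro SUP_least) auto
  then show ?thesis
    using ennreal_less_top le_less_trans by (metis infinity_ennreal_def)
qed

section \<open>Extremal functions\<close>

lemma le_decreasing_rearrangement_indicator:
  fixes E :: "(real ^ 'n::finite) set"
  assumes E: "emeasure lebesgue E > ennreal t" and M: "0 < M"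
  shows "ennreal M \<le> decreasing_rearrangement (\<lambda>x. of_real (M * indicator E x)) t"
  unfolding decreasing_rearrangement_def
proof (rule Inf_greatest, clarify)
  fix \<sigma> :: real
  assume \<sigma>: "\<sigma> > 0"
    "emeasure lebesgue {x. norm (complex_of_real (M * indicator E x)) > \<sigma>} \<le> ennreal t"
  show "ennreal M \<le> ennreal \<sigma>"
  proof (rule ccontr)
    assume "\<not> ?thesis"
    then have "\<sigma> < M" using \<sigma> by (auto simp: not_le ennreal_leI dest: not_le_imp_less)
    then have "{x. norm (complex_of_real (M * indicator E x)) > \<sigma>} = E"
      using \<sigma> M by (auto simp: indicator_def abs_mult split: if_splits)
    with \<sigma> E show False by simp
  qed
qed

text \<open>The mean of \<open>norm (f x) powr p\<close> over a dyadic cube is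
  \<open>M powr p\<close> times the density of \<open>E\<close> there, so the norm bound becomes a
  condition on densities alone. Local integrability comes from the finite measure of
  \<open>E\<close>.\<close>

lemma indicator_in_unit_ball:
  fixes E :: "(real ^ 'n::finite) set"
  assumes p: "0 < p" and M: "0 < M" and E: "E \<in> lmeasurable"
    and le: "\<And>j k. \<phi> (2 powi (- j)) * M *
        (measure lebesgue (E \<inter> dyadic_cube j k) / (2 powi (- j)) ^ CARD('n)) powr (1 / p) \<le> 1"
  defines "f \<equiv> (\<lambda>x. complex_of_real (M * indicator E x))"
  shows "f \<in> morrey_space \<phi> p" and "morrey_norm \<phi> p f \<le> 1"
proof -
  have f_powr: "norm (f x) powr p = M powr p * indicator E x" for x
    using M by (auto simp: f_def indicator_def)
  have E': "E \<in> sets lebesgue" using E by (simp add: fmeasurableD)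
  have int: "(LINT y:Q|lebesgue. norm (f y) powr p) = M powr p * measure lebesgue (E \<inter> Q)"
    if "Q \<in> sets lebesgue" for Q
  proof -
    have "(LINT y:Q|lebesgue. norm (f y) powr p)
        = (LINT y|lebesgue. M powr p * indicator (E \<inter> Q) y)"
      unfolding set_lebesgue_integral_def
      by (intro Bochner_Integration.integral_cong) (auto simp: f_powr indicator_def)
    then show ?thesis by simp
  qed
  show N: "morrey_norm \<phi> p f \<le> 1"
    unfolding morrey_norm_def
  proof (rule SUP_least, clarify)
    fix j and k :: "int ^ 'n"
    define r where "r = measure lebesgue (E \<inter> dyadic_cube j k) / (2 powi (- j)) ^ CARD('n)"
    have r: "0 \<le> r" by (simp add: r_def)
    have "(1 / measure lebesgue (dyadic_cube j k) *
        (LINT y:dyadic_cube j k|lebesgue. norm (f y) powr p)) powr (1 / p) = (M powr p * r) powr (1 / p)"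
      by (simp add: int measure_dyadic_cube r_def)
    also have "\<dots> = M * r powr (1 / p)"
      using M p r by (simp add: powr_mult powr_powr)
    finally show "ennreal (\<phi> (2 powi (- j)) * (1 / measure lebesgue (dyadic_cube j k) *
        (LINT y:dyadic_cube j k|lebesgue. norm (f y) powr p)) powr (1 / p)) \<le> 1"
      using le[of j k] by (simp add: r_def mult.assoc)
  qed
  have "f \<in> borel_measurable lebesgue"
    unfolding f_def using E' by measurable
  moreover have "set_integrable lebesgue K (\<lambda>x. norm (f x) powr p)" if "compact K" for K
  proof -
    have "integrable lebesgue (\<lambda>x. M powr p * indicator (E \<inter> K) x)"
      using E lmeasurable_compact[OF that]
      by (intro integrable_mult_right integrable_real_indicator)
        (auto simp: fmeasurable_def intro: le_less_trans[OF emeasure_mono[of _ E]])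
    moreover have "indicator K x *\<^sub>R norm (f x) powr p = M powr p * indicator (E \<inter> K) x" for x
      by (simp only: f_powr) (auto simp: indicator_def)
    ultimately show ?thesis
      unfolding set_integrable_def by presburger
  qed
  ultimately have "f \<in> Lp_loc p"
    by (simp add: Lp_loc_def)
  moreover have "morrey_norm \<phi> p f < \<infinity>"
    using N by (metis ennreal_one_less_top infinity_ennreal_def le_less_trans)
  ultimately show "f \<in> morrey_space \<phi> p"
    by (simp add: morrey_space_def)
qed

section \<open>Widely separated cubes\<close>

text \<open>The corners run along the diagonal in steps of \<open>2 * L\<close>, so that for
  \<open>l < L\<close> distinct cubes are separated in every coordinate at once and any single
  coordinate can be used to tell them apart.\<close>

definition sparse_cube :: "real \<Rightarrow> real \<Rightarrow> nat \<Rightarrow> (real ^ 'n) set" where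
  "sparse_cube l L i = cbox (vec (2 * L * real i)) (vec (2 * L * real i) + vec l)"

lemma sparse_cube_lebesgue [simp]: "sparse_cube l L i \<in> sets lebesgue"
  by (simp add: sparse_cube_def)

lemma emeasure_sparse_cube:
  "0 \<le> l \<Longrightarrow> emeasure lebesgue (sparse_cube l L i :: (real ^ 'n::finite) set) = ennreal (l ^ CARD('n))"
  unfolding sparse_cube_def by (rule emeasure_lebesgue_cube)

lemma sparse_cube_separated:
  fixes x y :: "real ^ 'n::finite"
  assumes "x \<in> sparse_cube l L i" "y \<in> sparse_cube l L i'" "i \<noteq> i'" "l < L"
  shows "\<bar>x $ m - y $ m\<bar> > L"
proof -
  have *: "z $ m < w $ m - L"
    if "z \<in> sparse_cube l L a" "w \<in> sparse_cube l L b" "a < b" for z w :: "real ^ 'n" and a b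
  proof -
    have z: "2 * L * real a \<le> z $ m" "z $ m \<le> 2 * L * real a + l" and w: "2 * L * real b \<le> w $ m"
      using that by (auto simp: sparse_cube_def mem_box_cart)
    \<comment> \<open>A point in a cube of side \<open>l\<close> forces \<open>0 \<le> l\<close>,
      hence \<open>L\<close> is positive.\<close>
    have "0 < L" using z assms(4) by linarith
    then have "2 * L * (real a + 1) \<le> 2 * L * real b"
      using that(3) by (intro mult_left_mono) auto
    with z w assms(4) show ?thesis
      by (simp add: algebra_simps)
  qed
  show ?thesis
    using *[OF assms(1,2)] *[OF assms(2,1)] assms(3) by (cases "i < i'") auto
qed

text \<open>A dyadic cube of side at most \<open>L\<close> is too narrow to meet two of the sparse
  cubes, so the intersection lies inside one of them.\<close>

lemma measure_Int_dyadic_cube_le: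
  fixes l L :: real and n :: nat
  assumes l: "0 < l" "l < L" and j: "2 powi (- j) \<le> L"
  shows "measure lebesgue ((\<Union>i<n. sparse_cube l L i) \<inter> (dyadic_cube j k :: (real ^ 'n::finite) set))
    \<le> l ^ CARD('n)"
proof -
  let ?Q = "dyadic_cube j k :: (real ^ 'n) set"
  have "\<exists>i. (\<Union>i<n. sparse_cube l L i) \<inter> ?Q \<subseteq> sparse_cube l L i"
  proof (cases "(\<Union>i<n. sparse_cube l L i) \<inter> ?Q = {}")
    case False
    then obtain x i where x: "x \<in> sparse_cube l L i" "x \<in> ?Q" by blast
    have "y \<in> sparse_cube l L i" if y: "y \<in> sparse_cube l L i'" "y \<in> ?Q" for y i'
    proof (rule ccontr)
      assume "y \<notin> sparse_cube l L i"
      then have "\<bar>x $ undefined - y $ undefined\<bar> > L"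
        using x y l by (intro sparse_cube_separated[of x l L i y i']) auto
      moreover have "\<bar>x $ undefined - y $ undefined\<bar> < 2 powi (- j)"
        using x(2) y(2) unfolding dyadic_cube_iff abs_less_iff by (smt (verit))
      ultimately show False using j by linarith
    qed
    then show ?thesis by blast
  qed auto
  then obtain i where "(\<Union>i<n. sparse_cube l L i) \<inter> ?Q \<subseteq> sparse_cube l L i" ..
  moreover have "(\<Union>i<n. sparse_cube l L i) \<inter> ?Q \<in> sets lebesgue"
    by (auto intro!: sets.Int sets.finite_UN)
  ultimately have "measure lebesgue ((\<Union>i<n. sparse_cube l L i) \<inter> ?Q)
      \<le> measure lebesgue (sparse_cube l L i :: (real ^ 'n) set)"
    by (intro measure_mono_fmeasurable) (auto simp: sparse_cube_def)
  also have "\<dots> = l ^ CARD('n)"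
    using l by (subst measure_def) (simp add: emeasure_sparse_cube del: emeasure_completion)
  finally show ?thesis .
qed

lemma emeasure_Union_sparse_cube:
  assumes l: "0 < l" "l < L"
  shows "emeasure lebesgue (\<Union>i<n. sparse_cube l L i :: (real ^ 'n::finite) set)
    = ennreal (real n * l ^ CARD('n))"
proof -
  have "disjoint_family_on (sparse_cube l L :: nat \<Rightarrow> (real ^ 'n) set) {..<n}"
    unfolding disjoint_family_on_def
    using sparse_cube_separated[of _ l L _ _ _ undefined] l by fastforce
  then have "emeasure lebesgue (\<Union>i<n. sparse_cube l L i :: (real ^ 'n) set)
      = (\<Sum>i<n. emeasure lebesgue (sparse_cube l L i :: (real ^ 'n) set))"
    by (intro sum_emeasure[symmetric]) auto
  also have "\<dots> = ennreal (real n * l ^ CARD('n))"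
    using l by (simp add: emeasure_sparse_cube ennreal_mult' ennreal_of_nat_eq_real_of_nat
        del: emeasure_completion)
  finally show ?thesis .
qed

section \<open>Arbitrarily high functions in the unit ball\<close>

lemma growth_envelope_ge:
  fixes \<phi> :: "real \<Rightarrow> real"
  assumes p: "0 < p" and \<phi>: "\<phi> \<in> morrey_weights CARD('n::finite) p"
    and lim0: "(\<phi> \<longlongrightarrow> 0) (at_right 0)"
    and lim: "((\<lambda>t. t powr (- (real CARD('n) / p)) * \<phi> t) \<longlongrightarrow> 0) at_top"
    and t: "0 < t" and M: "0 < M"
  shows "ennreal M \<le>
    growth_envelope (morrey_space \<phi> p :: (real ^ 'n \<Rightarrow> complex) set) (morrey_norm \<phi> p) t"
proof -
  let ?d = "real CARD('n)"
  have pos: "\<phi> s > 0" if "s > 0" for s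
    using \<phi> that by (auto simp: morrey_weights_def)
  have mono: "\<phi> s \<le> \<phi> s'" if "0 < s" "s \<le> s'" for s s'
    using \<phi> that by (auto simp: morrey_weights_def monotone_on_def)
  have anti: "\<phi> s' * s' powr (- (?d / p)) \<le> \<phi> s * s powr (- (?d / p))" if "0 < s" "s \<le> s'" for s s'
    using \<phi> that by (auto simp: morrey_weights_def monotone_on_def)
  have "eventually (\<lambda>l. \<phi> l < 1 / M) (at_right 0)"
    using M by (intro order_tendstoD[OF lim0]) auto
  then obtain b where b: "b > 0" "\<And>l. 0 < l \<Longrightarrow> l < b \<Longrightarrow> \<phi> l < 1 / M"
    by (auto simp: eventually_at_right_field)
  define l where "l = b / 2"
  have l: "l > 0" "\<phi> l * M \<le> 1"
  proof -
    show "l > 0" using b by (simp add: l_def)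
    have "\<phi> l < 1 / M" using b by (simp add: l_def)
    then show "\<phi> l * M \<le> 1" using M by (simp add: field_simps)
  qed
  \<comment> \<open>Enough cubes for their union to have measure above \<open>t\<close>. This fixes
    \<open>n\<close> before \<open>L\<close> is chosen, so that \<open>L\<close> may depend on
    it.\<close>
  obtain n where n: "t < real n * l ^ CARD('n)"
    using ex_less_of_nat_mult[of "l ^ CARD('n)" t] l by auto
  \<comment> \<open>The \<open>p\<close>-th root of the measure of the whole union, which is all
    that a very large cube sees.\<close>
  define B where "B = (real n * l ^ CARD('n)) powr (1 / p)"
  have B: "B > 0" using n t l by (auto simp: B_def intro!: Nat.gr0I)
  have "eventually (\<lambda>s. s powr (- (?d / p)) * \<phi> s < 1 / (M * B)) at_top"
    using M B by (intro order_tendstoD[OF lim]) auto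
  then obtain L0 where L0: "\<And>s. s \<ge> L0 \<Longrightarrow> s powr (- (?d / p)) * \<phi> s < 1 / (M * B)"
    by (auto simp: eventually_at_top_linorder)
  \<comment> \<open>Beyond \<open>L0\<close> the smallness of the weight beats \<open>M * B\<close>;
    the term \<open>l + 1\<close> ensures \<open>l < L\<close>.\<close>
  define L where "L = max L0 (l + 1)"
  have L: "l < L" "L0 \<le> L" by (auto simp: L_def)
  define E :: "(real ^ 'n) set" where "E = (\<Union>i<n. sparse_cube l L i)"
  have emE: "emeasure lebesgue E = ennreal (real n * l ^ CARD('n))"
    unfolding E_def by (rule emeasure_Union_sparse_cube[OF l(1) L(1)])
  have E: "E \<in> lmeasurable"
    unfolding fmeasurable_def using emE by (auto simp: E_def intro!: sets.finite_UN)
  have root: "(a / s ^ CARD('n)) powr (1 / p) = a powr (1 / p) * s powr (- (?d / p))"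
    if "0 < s" "0 \<le> a" for a s :: real
  proof -
    have "(s ^ CARD('n)) powr (1 / p) = s powr (?d / p)"
      using that by (simp add: powr_powr flip: powr_realpow)
    then show ?thesis
      using that by (simp add: powr_divide powr_minus field_simps)
  qed
  have le: "\<phi> s * M * (measure lebesgue (E \<inter> dyadic_cube j k) / s ^ CARD('n)) powr (1 / p) \<le> 1"
    if s_def: "s = 2 powi (- j)" for s j k
  proof -
    have s: "s > 0" by (simp add: s_def)
    have \<phi>s: "\<phi> s > 0" using pos s .
    let ?m = "measure lebesgue (E \<inter> dyadic_cube j k)"
    have "\<phi> s * M * (?m / s ^ CARD('n)) powr (1 / p) \<le> \<phi> s * M * (a / s ^ CARD('n)) powr (1 / p)"
      if "?m \<le> a" for a
      using that s p \<phi>s M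
      by (intro mult_left_mono powr_mono2 divide_right_mono) auto
    \<comment> \<open>By monotonicity in the measure, each range of \<open>s\<close> only needs an
      upper bound for \<open>?m\<close>: the volume of the dyadic cube, of one sparse cube, or of
      all of \<open>E\<close>.\<close>
    note step = order_trans[OF this]
    consider "s \<le> l" | "l < s" "s \<le> L" | "L < s" by linarith
    then show ?thesis
    proof cases
      case 1
      have "?m \<le> measure lebesgue (dyadic_cube j k :: (real ^ 'n) set)"
        using fmeasurableD[OF E]
        by (intro measure_mono_fmeasurable) (auto simp: fmeasurable_def emeasure_dyadic_cube)
      also have "\<dots> = s ^ CARD('n)"
        by (simp add: measure_dyadic_cube s_def)
      finally show ?thesis
      proof (rule step)
        have "\<phi> s * M \<le> \<phi> l * M"
          using mono[OF s 1] M by simp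
        with l s show "\<phi> s * M * (s ^ CARD('n) / s ^ CARD('n)) powr (1 / p) \<le> 1"
          by simp
      qed
    next
      case 2
      have "?m \<le> l ^ CARD('n)"
        unfolding E_def using measure_Int_dyadic_cube_le[OF l(1) L(1)] 2 s_def by blast
      then show ?thesis
      proof (rule step)
        have one: "(l ^ CARD('n)) powr (1 / p) * l powr (- (?d / p)) = 1"
          using root[of l "l ^ CARD('n)"] l by simp
        have "\<phi> s * M * (l ^ CARD('n) / s ^ CARD('n)) powr (1 / p)
            = (\<phi> s * s powr (- (?d / p))) * (M * (l ^ CARD('n)) powr (1 / p))"
          using root[of s "l ^ CARD('n)"] l s by simp
        \<comment> \<open>Passing from scale \<open>s\<close> down to \<open>l\<close> can only
          increase the weight, and at scale \<open>l\<close> the powers of \<open>l\<close> cancel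
          by \<open>one\<close>, which leaves the choice of \<open>l\<close>.\<close>
        also have "\<dots> \<le> (\<phi> l * l powr (- (?d / p))) * (M * (l ^ CARD('n)) powr (1 / p))"
          using anti[of l s] l 2 M by (intro mult_right_mono) auto
        also have "\<dots> = \<phi> l * M * ((l ^ CARD('n)) powr (1 / p) * l powr (- (?d / p)))"
          by (simp add: mult_ac)
        also have "\<dots> \<le> 1"
          using l one by simp
        finally show "\<phi> s * M * (l ^ CARD('n) / s ^ CARD('n)) powr (1 / p) \<le> 1" .
      qed
    next
      case 3
      have "?m \<le> measure lebesgue E"
        using E by (intro measure_mono_fmeasurable) (auto simp: fmeasurableD)
      also have "\<dots> = real n * l ^ CARD('n)"
        using emE l by (simp add: measure_def)
      finally show ?thesis
      proof (rule step)
        have "\<phi> s * M * (real n * l ^ CARD('n) / s ^ CARD('n)) powr (1 / p)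
            = (s powr (- (?d / p)) * \<phi> s) * (M * B)"
          using root[of s "real n * l ^ CARD('n)"] l s by (simp add: B_def)
        also have "\<dots> \<le> 1 / (M * B) * (M * B)"
          using L0[of s] 3 L M B by (intro mult_right_mono) auto
        also have "\<dots> = 1"
          using M B by simp
        finally show "\<phi> s * M * (real n * l ^ CARD('n) / s ^ CARD('n)) powr (1 / p) \<le> 1" .
      qed
    qed
  qed
  have "ennreal M \<le> decreasing_rearrangement (\<lambda>x. complex_of_real (M * indicator E x)) t"
    using n t by (intro le_decreasing_rearrangement_indicator M) (simp add: emE ennreal_lessI)
  also have "\<dots> \<le> growth_envelope (morrey_space \<phi> p :: (real ^ 'n \<Rightarrow> complex) set) (morrey_norm \<phi> p) t"
    unfolding growth_envelope_def
    using indicator_in_unit_ball[OF p M E le[OF refl]]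
    by (intro SUP_upper) auto
  finally show ?thesis .
qed

section \<open>The equivalence\<close>

theorem corollary2p18:
  fixes p :: real and \<phi> :: "real \<Rightarrow> real"
  assumes "0 < p"
    and "\<phi> \<in> morrey_weights CARD('n::finite) p"
    and "\<phi> 1 = 1"
    and "(\<phi> \<longlongrightarrow> 0) (at_right 0)"
  shows "(\<forall>t>0. growth_envelope (morrey_space \<phi> p :: (real ^ 'n \<Rightarrow> complex) set)
                  (morrey_norm \<phi> p) t = \<infinity>)
    \<longleftrightarrow> ((\<lambda>t. t powr (- (real CARD('n) / p)) * \<phi> t) \<longlongrightarrow> 0) at_top"
proof
  let ?g = "\<lambda>t. t powr (- (real CARD('n) / p)) * \<phi> t"
  assume inf: "\<forall>t>0. growth_envelope (morrey_space \<phi> p :: (real ^ 'n \<Rightarrow> complex) set)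
      (morrey_norm \<phi> p) t = \<infinity>"
  show "(?g \<longlongrightarrow> 0) at_top"
  proof (rule order_tendstoI)
    fix c :: real
    assume "c < 0"
    then have "c < ?g t" if "t > 0" for t
      using assms(2) that
      by (auto simp: morrey_weights_def intro: less_trans[OF _ mult_pos_pos])
    then show "eventually (\<lambda>t. c < ?g t) at_top"
      using eventually_gt_at_top[of 0] by (rule eventually_mono[rotated])
  next
    fix c :: real
    assume "0 < c"
    \<comment> \<open>If \<open>?g\<close> stayed above \<open>c\<close> everywhere, the envelope
      would be finite at \<open>1\<close>. One point below \<open>c\<close> is enough, because
      \<open>?g\<close> is nonincreasing.\<close>
    then obtain s where s: "s > 0" "?g s < c"
      using growth_envelope_finite[where 'n = 'n, OF assms(1), of c \<phi>] inf by (force simp: not_le)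
    have "?g t \<le> ?g s" if "s \<le> t" for t
      using assms(2) that s by (auto simp: morrey_weights_def monotone_on_def mult.commute)
    then have "?g t < c" if "s \<le> t" for t
      using s(2) that le_less_trans by blast
    then show "eventually (\<lambda>t. ?g t < c) at_top"
      using eventually_ge_at_top[of s] by (rule eventually_mono[rotated])
  qed
next
  assume lim: "((\<lambda>t. t powr (- (real CARD('n) / p)) * \<phi> t) \<longlongrightarrow> 0) at_top"
  show "\<forall>t>0. growth_envelope (morrey_space \<phi> p :: (real ^ 'n \<Rightarrow> complex) set)
      (morrey_norm \<phi> p) t = \<infinity>"
  proof (intro allI impI)
    fix t :: real
    assume "t > 0"
    note ge = growth_envelope_ge[OF assms(1,2,4) lim this]
    let ?G = "growth_envelope (morrey_space \<phi> p :: (real ^ 'n \<Rightarrow> complex) set) (morrey_norm \<phi> p) t"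
    show "?G = \<infinity>"
    proof (cases ?G)
      case (real r)
      \<comment> \<open>A finite value \<open>r\<close> contradicts the lower bound at height
        \<open>r + 1\<close>.\<close>
      with ge[of "r + 1"] show ?thesis by simp
    qed simp
  qed
qed

end
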